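(* There exists an infinite set $\mathcal S$ of prime numbers, all congruent to $2\pmod 3$, such that for every $p\in\mathcal S$: (1) for every $n\in\mathbb Z$ with $n\equiv 1/3\pmod{p-1}$ we have $\nu_p(T(n))\ge \nu_p(n-1/3)$; (2) for every $n\in\mathbb Z$ with $n\equiv -5/3\pmod{p-1}$ we have $\nu_p(T(n))\ge \nu_p(n+5/3)$.
   Context: $T:\mathbb Z\to\mathbb Z$ is the Tribonacci sequence: $T(0)=0$, $T(1)=T(2)=1$, $T(n+3)=T(n+2)+T(n+1)+T(n)$ for all $n\in\mathbb Z$. For a prime $p$, $\nu_p$ is the $p$-adic valuation on $\mathbb Q$, with $\nu_p(0)=+\infty$. Convention for congruences of rationals: for $x,y\in\mathbb Q$ and a positive integer $M$, $x\equiv y\pmod M$ means there exists $m\in\mathbb Z$ with $\gcd(m,M)=1$, $mx,my\in\mathbb Z$ and $mx\equiv my\pmod M$ (for $p\equiv 2\pmod 3$ one has $3\nmid p-1$, so the classes $1/3$ and $-5/3$ modulo $p-1$ make sense). *)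

theory Defs
  imports "HOL-Number_Theory.Number_Theory" "HOL-Library.Extended_Real"
begin

text \<open>Tribonacci sequence on the integers: forward triples (T n, T (n+1), T (n+2)) for n \<ge> 0
  and backward triples (T (-k), T (-k+1), T (-k+2)) for k \<ge> 0.\<close>

fun trib_fwd :: "nat \<Rightarrow> int \<times> int \<times> int" where
  "trib_fwd 0 = (0, 1, 1)"
| "trib_fwd (Suc k) = (case trib_fwd k of (a, b, c) \<Rightarrow> (b, c, a + b + c))"

fun trib_bwd :: "nat \<Rightarrow> int \<times> int \<times> int" where
  "trib_bwd 0 = (0, 1, 1)"
| "trib_bwd (Suc k) = (case trib_bwd k of (a, b, c) \<Rightarrow> (c - b - a, a, b))"

definition trib :: "int \<Rightarrow> int" where
  "trib n = (if n \<ge> 0 then fst (trib_fwd (nat n)) else fst (trib_bwd (nat (- n))))"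

definition padic_val :: "nat \<Rightarrow> rat \<Rightarrow> ereal" where
  "padic_val p x = (if x = 0 then \<infinity> else
     (case quotient_of x of (a, b) \<Rightarrow>
        ereal (real_of_int (int (multiplicity (int p) a) - int (multiplicity (int p) b)))))"

definition rat_cong :: "rat \<Rightarrow> rat \<Rightarrow> nat \<Rightarrow> bool" where
  "rat_cong x y M = (\<exists>m a b :: int. coprime m (int M) \<and> of_int a = of_int m * x \<and>
       of_int b = of_int m * y \<and> [a = b] (mod int M))"

lemma "trib 0 = 0 \<and> trib 1 = 1 \<and> trib 2 = 1 \<and> trib 3 = 2 \<and> trib 4 = 4 \<and> trib (-1) = 0
   \<and> trib (-2) = 1 \<and> trib (-3) = -1 \<and> trib (-4) = 0"
  by (simp add: trib_def numeral_eq_Suc)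

end

theory Submission
  imports Defs "HOL-Computational_Algebra.Polynomial"
begin

text \<open>
  Let $f = x^3 - x^2 - x - 1$ and let $\theta$ be the class of $x$ in $\mathbb{Z}[x]/(f)$. The key
  identity is $(\theta + 1)^3 = 2\theta^4$. If $f$ splits into distinct linear factors modulo $p$,
  then $\theta$ and $\theta + 1$ have order dividing $(p-1)p^k$ modulo $p^{k+1}$. Hence, if
  $(p-1)p^k$ divides $3n - 1$, then raising the identity to the $n$-th power gives
  $2^n \theta^{n+1} \equiv \theta + 1$ modulo $p^{k+1}$. The linear functionals
  $\theta^i \mapsto T(i-1)$ and $\theta^i \mapsto T(i-3)$ vanish at $\theta + 1$, so $p^{k+1}$
  divides both $T(n)$ and $T(n-2)$; the class $-5/3$ is the class $1/3$ shifted by $2$.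

  Infinitely many primes $p \equiv 2 \pmod 3$ with $f$ split modulo $p$ are found by Euclid's
  argument. Let $M$ be $22$ times the product of those already found, and write
  $f(M + M\sqrt{-11}) = x + y\sqrt{-11}$. The norm $x^2 + 11y^2$ is $1$ modulo $M$ and $2$ modulo
  $3$, so some prime $p \equiv 2 \pmod 3$ divides it to an odd power. Then $-11$ is a square
  modulo $p$, whence $f$ has a root modulo $p$, and it splits because its discriminant is $-44$.
\<close>

section \<open>The recurrence on all integer indices\<close>

lemma trib_fwd_eq: "trib_fwd k = (trib (int k), trib (int k + 1), trib (int k + 2))"
proof -
  have "nat (int k + 1) = Suc k" "nat (int k + 2) = Suc (Suc k)" by auto
  then show ?thesis
    by (cases "trib_fwd k") (auto simp: trib_def)
qed

text \<open>The window at -k reaches nonnegative indices when k is small. Its two upper entries are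
  inherited in the induction, so only the new lowest entry is read off the definition.\<close>

lemma trib_bwd_eq: "trib_bwd k = (trib (- int k), trib (1 - int k), trib (2 - int k))"
proof (induction k)
  case 0
  show ?case by (simp add: trib_def numeral_eq_Suc)
next
  case (Suc k)
  have "trib (- int (Suc k)) = fst (trib_bwd (Suc k))"
    by (simp add: trib_def nat_add_distrib del: trib_bwd.simps)
  with Suc show ?case by simp
qed

lemma trib_rec: "trib (n + 3) = trib (n + 2) + trib (n + 1) + trib n"
proof (cases "n \<ge> 0")
  case True
  then obtain k where n: "n = int k" by (rule nonneg_eq_int)
  show ?thesis using trib_fwd_eq[of k] trib_fwd_eq[of "Suc k"] by (simp add: n add_ac)
next
  case False
  then obtain k where n: "n = - int (Suc k)"
    by (cases n rule: int_cases) auto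
  show ?thesis using trib_bwd_eq[of k] trib_bwd_eq[of "Suc k"] by (simp add: n)
qed

section \<open>Shift functionals on polynomials\<close>

definition trib_poly :: "int poly" where
  "trib_poly = [:-1, -1, -1, 1:]"

lemma poly_trib_poly: "poly trib_poly a = a ^ 3 - a\<^sup>2 - a - 1"
  by (simp add: trib_poly_def algebra_simps power2_eq_square power3_eq_cube)

text \<open>This is the linear functional on \<int>[x] that sends x^i to T(n + i), for i \<ge>
  0.\<close>

definition trib_action :: "int \<Rightarrow> int poly \<Rightarrow> int" where
  "trib_action n u = (\<Sum>i\<le>degree u. coeff u i * trib (n + int i))"

text \<open>Padding with zero coefficients lets polynomials of different degrees share one summation
  range.\<close>

lemma trib_action_bound:
  assumes "degree u \<le> N"
  shows "trib_action n u = (\<Sum>i\<le>N. coeff u i * trib (n + int i))"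
  unfolding trib_action_def using assms
  by (intro sum.mono_neutral_left) (auto simp: coeff_eq_0)

lemma trib_action_add: "trib_action n (u + v) = trib_action n u + trib_action n v"
proof -
  let ?N = "max (degree u) (degree v)"
  have "degree (u + v) \<le> ?N" by (rule degree_add_le_max)
  then show ?thesis
    by (simp add: trib_action_bound[of _ ?N] algebra_simps sum.distrib)
qed

lemma trib_action_smult: "trib_action n (smult c u) = c * trib_action n u"
  by (cases "c = 0") (simp_all add: trib_action_def sum_distrib_left mult_ac)

lemma trib_action_0 [simp]: "trib_action n 0 = 0"
  by (simp add: trib_action_def)

lemma trib_action_pCons: "trib_action n (pCons c u) = c * trib n + trib_action (n + 1) u"
proof -
  have "trib_action n (pCons c u) = (\<Sum>i\<le>Suc (degree u). coeff (pCons c u) i * trib (n + int i))"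
    by (rule trib_action_bound) (rule degree_pCons_le)
  also have "\<dots> = c * trib n + trib_action (n + 1) u"
    unfolding sum.atMost_Suc_shift by (simp add: trib_action_def add_ac)
  finally show ?thesis .
qed

lemma trib_action_diff: "trib_action n (u - v) = trib_action n u - trib_action n v"
  using trib_action_add[of n "u - v" v] by simp

lemma trib_action_X_power: "trib_action n ([:0, 1:] ^ j) = trib (n + int j)"
  by (induction j arbitrary: n) (simp_all add: trib_action_pCons one_pCons add_ac)

text \<open>The recurrence at n kills f itself, and a factor x only shifts n. The induction
  therefore keeps n arbitrary, and the whole ideal (f) is killed.\<close>

lemma trib_action_trib_poly_mult: "trib_action n (trib_poly * q) = 0"
proof (induction q arbitrary: n rule: pCons_induct)
  case 0
  show ?case by simp
next
  case (pCons c q)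
  have "trib_action n trib_poly = 0"
    using trib_rec[of n] by (simp add: trib_poly_def trib_action_pCons add_ac)
  with pCons show ?case
    by (simp add: trib_action_add trib_action_smult trib_action_pCons)
qed

section \<open>Congruence modulo the ideal (f, m)\<close>

text \<open>Equality in (\<int>/m)[\<theta>], expressed by explicit witnesses in \<int>[x] so that
  no quotient ring has to be built.\<close>

definition trib_cong :: "int \<Rightarrow> int poly \<Rightarrow> int poly \<Rightarrow> bool" where
  "trib_cong m u v \<longleftrightarrow> (\<exists>q r. u - v = trib_poly * q + [:m:] * r)"

lemma trib_congI: "u - v = trib_poly * q + [:m:] * r \<Longrightarrow> trib_cong m u v"
  unfolding trib_cong_def by blast

text \<open>The functional kills multiples of f and is linear, so modulo m it is well defined on
  classes.\<close>

lemma trib_cong_action: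
  assumes "trib_cong m u v"
  shows "m dvd trib_action n u - trib_action n v"
proof -
  from assms obtain q r where "u - v = trib_poly * q + [:m:] * r"
    unfolding trib_cong_def by blast
  then have "trib_action n (u - v) = m * trib_action n r"
    by (simp add: trib_action_add trib_action_smult trib_action_trib_poly_mult)
  then show ?thesis by (simp add: trib_action_diff)
qed

lemma trib_cong_refl: "trib_cong m u u"
  by (rule trib_congI[of _ _ 0 _ 0]) simp

lemma trib_cong_sym:
  assumes "trib_cong m u v"
  shows "trib_cong m v u"
proof -
  from assms obtain q r where "u - v = trib_poly * q + [:m:] * r"
    unfolding trib_cong_def by blast
  then have "v - u = trib_poly * (- q) + [:m:] * (- r)" by (simp add: algebra_simps)
  then show ?thesis by (rule trib_congI)
qed

lemma trib_cong_trans: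
  assumes "trib_cong m u v" "trib_cong m v w"
  shows "trib_cong m u w"
proof -
  from assms obtain q r q' r' where
    "u - v = trib_poly * q + [:m:] * r" "v - w = trib_poly * q' + [:m:] * r'"
    unfolding trib_cong_def by blast
  then have "u - w = trib_poly * (q + q') + [:m:] * (r + r')"
    unfolding distrib_left by (simp add: algebra_simps)
  then show ?thesis by (rule trib_congI)
qed

lemma trib_cong_add:
  assumes "trib_cong m u v" "trib_cong m u' v'"
  shows "trib_cong m (u + u') (v + v')"
proof -
  from assms obtain q r q' r' where
    "u - v = trib_poly * q + [:m:] * r" "u' - v' = trib_poly * q' + [:m:] * r'"
    unfolding trib_cong_def by blast
  then have "(u + u') - (v + v') = trib_poly * (q + q') + [:m:] * (r + r')"
    unfolding distrib_left by (simp add: algebra_simps)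
  then show ?thesis by (rule trib_congI)
qed

lemma trib_cong_mult_left:
  assumes "trib_cong m u v"
  shows "trib_cong m (w * u) (w * v)"
proof -
  from assms obtain q r where "u - v = trib_poly * q + [:m:] * r"
    unfolding trib_cong_def by blast
  then have "w * u - w * v = trib_poly * (w * q) + [:m:] * (w * r)"
    unfolding right_diff_distrib[symmetric] by (simp only: distrib_left mult.left_commute)
  then show ?thesis by (rule trib_congI)
qed

lemma trib_cong_mult:
  assumes "trib_cong m u v" "trib_cong m u' v'"
  shows "trib_cong m (u * u') (v * v')"
  using trib_cong_trans[OF trib_cong_mult_left[OF assms(2), of u] ]
    trib_cong_mult_left[OF assms(1), of v'] by (simp add: mult.commute)

lemma trib_cong_power: "trib_cong m u v \<Longrightarrow> trib_cong m (u ^ n) (v ^ n)"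
  by (induction n) (auto intro: trib_cong_mult trib_cong_refl)

lemma trib_cong_sum:
  "(\<And>i. i \<in> A \<Longrightarrow> trib_cong m (g i) (h i)) \<Longrightarrow> trib_cong m (sum g A) (sum h A)"
  by (induction A rule: infinite_finite_induct) (auto intro: trib_cong_add trib_cong_refl)

lemma trib_cong_dvd_modulus:
  assumes "trib_cong m u v" "d dvd m"
  shows "trib_cong d u v"
proof -
  from assms obtain q r c where "u - v = trib_poly * q + [:m:] * r" "m = d * c"
    unfolding trib_cong_def by blast
  then have "u - v = trib_poly * q + [:d:] * ([:c:] * r)" by (simp add: mult_ac)
  then show ?thesis by (rule trib_congI)
qed

text \<open>Factor u^p - 1 = (u - 1)(1 + u + ... + u^(p-1)). Modulo f the first factor is a multiple
  of m, and the second is a multiple of p because each of its p terms is 1 modulo p.\<close>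

lemma trib_cong_power_1_lift:
  assumes "trib_cong m u 1" "int p dvd m"
  shows "trib_cong (m * int p) (u ^ p) 1"
proof -
  have "trib_cong (int p) (\<Sum>i<p. u ^ i) (\<Sum>i<p. 1)"
  proof (rule trib_cong_sum)
    fix i
    show "trib_cong (int p) (u ^ i) 1"
      using trib_cong_power[OF trib_cong_dvd_modulus[OF assms], of i] by simp
  qed
  moreover have "(\<Sum>i<p. 1 :: int poly) = [:int p:]"
    by (simp add: of_nat_poly)
  ultimately obtain q r where S: "(\<Sum>i<p. u ^ i) - [:int p:] = trib_poly * q + [:int p:] * r"
    unfolding trib_cong_def by metis
  from assms obtain q' r' where u: "u - 1 = trib_poly * q' + [:m:] * r'"
    unfolding trib_cong_def by blast
  have S': "(\<Sum>i<p. u ^ i) = trib_poly * q + [:int p:] * (r + 1)"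
    using S by (simp only: algebra_simps)
  have mp: "[:m * int p:] = [:m:] * [:int p:]" by simp
  have "u ^ p - 1 = (u - 1) * (\<Sum>i<p. u ^ i)"
    by (rule power_diff_1_eq)
  also have "\<dots> = trib_poly * (q' * (trib_poly * q + [:int p:] * (r + 1)) + [:m:] * r' * q) + [:m * int p:] * (r' * (r + 1))"
    unfolding u S' mp by (simp only: algebra_simps)
  finally show ?thesis by (rule trib_congI)
qed

lemma trib_cong_power_1_prime_power:
  assumes "trib_cong (int p) (u ^ d) 1"
  shows "trib_cong (int p ^ Suc k) (u ^ (d * p ^ k)) 1"
proof (induction k)
  case 0
  then show ?case using assms by simp
next
  case (Suc k)
  from trib_cong_power_1_lift[OF this, of p] show ?case
    by (simp add: power_mult[symmetric] mult_ac)
qed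

section \<open>The cube identity and divisibility of Tribonacci numbers\<close>

text \<open>Over \<int> one has (x + 1)^3 - 2x^4 = -(2x + 1) f, so the congruence holds for every
  m.\<close>

lemma trib_cong_cube: "trib_cong m ([:1, 1:] ^ 3) ([:2:] * [:0, 1:] ^ 4)"
  by (rule trib_congI[of _ _ "[:-1, -2:]" _ 0]) (simp add: trib_poly_def numeral_eq_Suc)

text \<open>Here j is an inverse of 3 modulo d. The j-th power of the cube identity turns the left
  side into (\<theta> + 1)^(di + 1) = \<theta> + 1, and on the right 4j = (j + 1) + di leaves
  \<theta>^(j + 1).\<close>

lemma two_power_X_power_cong:
  assumes X: "trib_cong m ([:0, 1:] ^ d) 1" and Y: "trib_cong m ([:1, 1:] ^ d) 1"
    and j: "3 * j = d * i + 1"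
  shows "trib_cong m ([:2 ^ j:] * [:0, 1:] ^ Suc j) [:1, 1:]"
proof -
  have "trib_cong m ([:1, 1:] * ([:1, 1:] ^ d) ^ i) ([:1, 1:] * 1 ^ i)"
    by (intro trib_cong_mult_left trib_cong_power Y)
  moreover have "([:1, 1:] :: int poly) * ([:1, 1:] ^ d) ^ i = ([:1, 1:] ^ 3) ^ j"
    unfolding power_mult[symmetric] j by simp
  ultimately have 1: "trib_cong m (([:1, 1:] ^ 3) ^ j) [:1, 1:]" by simp
  have 2: "trib_cong m (([:1, 1:] ^ 3) ^ j) (([:2:] * [:0, 1:] ^ 4) ^ j)"
    by (intro trib_cong_power trib_cong_cube)
  have "trib_cong m ([:2 ^ j:] * [:0, 1:] ^ Suc j * ([:0, 1:] ^ d) ^ i)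
      ([:2 ^ j:] * [:0, 1:] ^ Suc j * 1 ^ i)"
    by (intro trib_cong_mult_left trib_cong_power X)
  moreover have "[:2 ^ j:] * [:0, 1:] ^ Suc j * ([:0, 1:] ^ d) ^ i = ([:2:] * [:0, 1:] ^ 4 :: int poly) ^ j"
  proof -
    have "Suc j + d * i = 4 * j" using j by simp
    then have "([:0, 1:] :: int poly) ^ Suc j * ([:0, 1:] ^ d) ^ i = ([:0, 1:] ^ 4) ^ j"
      by (simp only: power_mult[symmetric] power_add[symmetric])
    moreover have "[:2 ^ j:] = ([:2:] :: int poly) ^ j"
      by (simp add: poly_const_pow)
    ultimately show ?thesis by (simp only: power_mult_distrib mult.assoc)
  qed
  ultimately have 3: "trib_cong m (([:2:] * [:0, 1:] ^ 4) ^ j) ([:2 ^ j:] * [:0, 1:] ^ Suc j)"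
    by simp
  show ?thesis
    using trib_cong_trans[OF trib_cong_sym[OF trib_cong_trans[OF 2 3]] 1] .
qed

lemma trib_periodic:
  assumes "trib_cong m ([:0, 1:] ^ d) 1"
  shows "m dvd trib (n + int (d * i)) - trib n"
proof -
  have "trib_cong m ([:0, 1:] ^ (d * i)) 1"
    using trib_cong_power[OF assms, of i] by (simp add: power_mult)
  from trib_cong_action[OF this, of n] show ?thesis
    by (simp only: trib_action_X_power) (simp add: one_pCons trib_action_pCons)
qed

lemma trib_dvd_of_power_cong:
  assumes X: "trib_cong m ([:0, 1:] ^ d) 1" and Y: "trib_cong m ([:1, 1:] ^ d) 1"
    and d: "d > 0" "int d dvd 3 * n - 1" and m: "coprime m 2"
  shows "m dvd trib n" "m dvd trib (n - 2)"
proof -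
  \<comment> \<open>Powers need a natural exponent: adding d * e makes n positive and changes
    neither n modulo d nor, by periodicity, T(n) modulo m.\<close>
  define e where "e = nat (\<bar>n\<bar> + 1)"
  define j where "j = nat (n + int (d * e))"
  have "\<bar>n\<bar> + 1 \<le> int (d * e)"
  proof -
    have "1 * e \<le> d * e" using d by (intro mult_le_mono) auto
    then have "int e \<le> int (d * e)" by (simp only: mult_1 of_nat_le_iff)
    then show ?thesis by (simp add: e_def)
  qed
  then have "n + int (d * e) > 0" by linarith
  then have j: "int j = n + int (d * e)" and "j > 0" by (simp_all add: j_def)
  have "3 * int j - 1 = (3 * n - 1) + int d * (3 * int e)" using j by simp
  then have dj: "int d dvd 3 * int j - 1" using d by (metis dvd_add dvd_triv_left)
  obtain i where i: "3 * j = d * i + 1"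
  proof -
    have "int d dvd int (3 * j - 1)" using dj \<open>j > 0\<close> by (simp add: of_nat_diff)
    then have "d dvd 3 * j - 1" by (simp only: int_dvd_int_iff)
    then obtain i where "3 * j - 1 = d * i" by blast
    with \<open>j > 0\<close> have "3 * j = d * i + 1" by simp
    then show ?thesis by (rule that)
  qed
  have cm: "coprime m (2 ^ j)" using m by simp
  note c = trib_cong_action[OF two_power_X_power_cong[OF X Y i]]
  have act: "trib_action l ([:2 ^ j:] * [:0, 1:] ^ Suc j) = 2 ^ j * trib (l + int (Suc j))" for l
    by (simp only: trib_action_smult trib_action_X_power mult_pCons_left mult_zero_left pCons_0_0 add_0_right)
  have act1: "trib_action l [:1, 1:] = trib l + trib (l + 1)" for l
    by (simp add: trib_action_pCons)
  \<comment> \<open>The shift -1 kills \<theta> + 1 because T(-1) + T(0) = 0.\<close>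
  have "m dvd 2 ^ j * trib (int j)"
    using c[of "-1"] unfolding act act1 by (simp add: trib_def numeral_eq_Suc)
  then have "m dvd trib (int j)" using cm by (simp add: coprime_dvd_mult_right_iff)
  moreover have "m dvd trib (int j) - trib n"
    using trib_periodic[OF X, of n e] unfolding j .
  ultimately show "m dvd trib n" by (metis dvd_diff diff_diff_eq2 add_diff_cancel_left')
  \<comment> \<open>The shift -3 does the same, since T(-3) + T(-2) = -1 + 1 = 0.\<close>
  have "m dvd 2 ^ j * trib (int j - 2)"
    using c[of "-3"] unfolding act act1 by (simp add: trib_def numeral_eq_Suc)
  then have "m dvd trib (int j - 2)" using cm by (simp add: coprime_dvd_mult_right_iff)
  moreover have "m dvd trib (int j - 2) - trib (n - 2)"
    using trib_periodic[OF X, of "n - 2" e] unfolding j by (simp add: algebra_simps)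
  ultimately show "m dvd trib (n - 2)" by (metis dvd_diff diff_diff_eq2 add_diff_cancel_left')
qed

section \<open>Splitting of f modulo p and Fermat's little theorem\<close>

text \<open>Divide \<open>h\<close> successively by x - a, x - b and x - c. As the roots are
  distinct modulo p, all three remainders vanish modulo p, and what is left is a multiple of (x -
  a)(x - b)(x - c).\<close>

lemma trib_cong_0_if_roots:
  assumes p: "prime p"
    and split: "trib_cong p ([:-a, 1:] * [:-b, 1:] * [:-c, 1:]) 0"
    and ne: "\<not> p dvd a - b" "\<not> p dvd a - c" "\<not> p dvd b - c"
    and h: "p dvd poly h a" "p dvd poly h b" "p dvd poly h c"
  shows "trib_cong p h 0"
proof -
  have div: "h = [:-a, 1:] * synthetic_div h a + [:poly h a:]" for h :: "int poly" and a
    using synthetic_div_correct'[of a h] by simp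
  have const: "trib_cong p [:z:] 0" if "p dvd z" for z
  proof -
    from that obtain w where "z = p * w" by blast
    then have "[:z:] - 0 = trib_poly * 0 + [:p:] * [:w:]" by simp
    then show ?thesis by (rule trib_congI)
  qed
  define h1 where "h1 = synthetic_div h a"
  define h2 where "h2 = synthetic_div h1 b"
  define h3 where "h3 = synthetic_div h2 c"
  have h1: "h = [:-a, 1:] * h1 + [:poly h a:]" unfolding h1_def by (rule div)
  have h2: "h1 = [:-b, 1:] * h2 + [:poly h1 b:]" unfolding h2_def by (rule div)
  have h3: "h2 = [:-c, 1:] * h3 + [:poly h2 c:]" unfolding h3_def by (rule div)
  have cancel: "p dvd poly g z" if "u = [:-y, 1:] * g + [:poly u y:]" "p dvd poly u y"
    "p dvd poly u z" "\<not> p dvd y - z" for u g y z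
  proof -
    have "poly u z = (z - y) * poly g z + poly u y"
      by (subst that(1)) (simp add: algebra_simps)
    then have "p dvd (z - y) * poly g z" using that(2,3) by (metis dvd_add_left_iff)
    then show ?thesis using p that(4) by (metis dvd_minus_iff minus_diff_eq prime_dvd_mult_iff)
  qed
  have b1: "p dvd poly h1 b" using cancel[OF h1 h(1,2) ne(1)] .
  have c1: "p dvd poly h1 c" using cancel[OF h1 h(1,3) ne(2)] .
  have c2: "p dvd poly h2 c" using cancel[OF h2 b1 c1 ne(3)] .
  have "trib_cong p ([:-a, 1:] * ([:-b, 1:] * [:poly h2 c:] + [:poly h1 b:]) + [:poly h a:])
      ([:-a, 1:] * ([:-b, 1:] * 0 + 0) + 0)"
    by (intro trib_cong_add trib_cong_mult_left const h b1 c2)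
  moreover have "trib_cong p (h3 * ([:-a, 1:] * [:-b, 1:] * [:-c, 1:])) (h3 * 0)"
    by (intro trib_cong_mult_left split)
  ultimately have "trib_cong p (h3 * ([:-a, 1:] * [:-b, 1:] * [:-c, 1:]) +
      ([:-a, 1:] * ([:-b, 1:] * [:poly h2 c:] + [:poly h1 b:]) + [:poly h a:])) 0"
    using trib_cong_add by fastforce
  also have "h3 * ([:-a, 1:] * [:-b, 1:] * [:-c, 1:]) +
      ([:-a, 1:] * ([:-b, 1:] * [:poly h2 c:] + [:poly h1 b:]) + [:poly h a:]) =
      [:-a, 1:] * ([:-b, 1:] * ([:-c, 1:] * h3 + [:poly h2 c:]) + [:poly h1 b:]) + [:poly h a:]"
    by (simp only: distrib_left mult_ac add_ac)
  finally show ?thesis using h1 h2 h3 by simp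
qed

lemma trib_poly_splits_mod_prime:
  fixes p a s :: int
  assumes p: "prime p" "\<not> p dvd 2" "\<not> p dvd 11"
    and a: "p dvd poly trib_poly a" and s: "p dvd s\<^sup>2 + 11"
  obtains b c r where "trib_poly = [:-a, 1:] * [:-b, 1:] * [:-c, 1:] + [:p:] * r"
    "\<not> p dvd a - b" "\<not> p dvd a - c" "\<not> p dvd b - c"
proof -
  define F where "F = 3 * a\<^sup>2 - 2 * a - 1"
  obtain k where k: "a ^ 3 - a\<^sup>2 - a - 1 = p * k"
    using a unfolding poly_trib_poly by (rule dvdE)
  obtain l where l: "s\<^sup>2 = p * l - 11"
    using s by (metis dvdE add_diff_cancel_right')
  \<comment> \<open>The quadratic $f/(x - a)$ has discriminant $-3a^2 + 2a + 5$, and $F = f'(a)$;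
    so $b, c = (1 - a \pm 2s/F)/2$ modulo $p$, with $e$ below the inverse of $2F$.\<close>
  have disc: "(- 3 * a\<^sup>2 + 2 * a + 5) * F\<^sup>2 + 44 = p * (k * (- 27 * a ^ 3 + 27 * a\<^sup>2 + 27 * a - 49))"
  proof -
    \<comment> \<open>This is disc(f) = disc(f/(x - a)) f'(a)^2 with disc(f) = -44, valid modulo
      f(a); the last factor is the quotient on division by f(a).\<close>
    have "(- 3 * a\<^sup>2 + 2 * a + 5) * F\<^sup>2 + 44 = (a ^ 3 - a\<^sup>2 - a - 1) * (- 27 * a ^ 3 + 27 * a\<^sup>2 + 27 * a - 49)"
      unfolding F_def by (simp add: algebra_simps power2_eq_square power3_eq_cube)
    then show ?thesis using k by simp
  qed
  have "\<not> p dvd 2 * 2 * 11" using p by (simp only: prime_dvd_mult_iff) simp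
  then have "\<not> p dvd 44" by simp
  have F: "\<not> p dvd F"
  proof
    assume "p dvd F"
    then have "p dvd (- 3 * a\<^sup>2 + 2 * a + 5) * F\<^sup>2" by (simp add: power2_eq_square)
    then have "p dvd 44" using disc by (metis dvd_add_right_iff dvd_triv_left)
    with \<open>\<not> p dvd 44\<close> show False by simp
  qed
  have "\<not> p dvd 2 * F" using p F by (simp add: prime_dvd_mult_iff)
  then have "coprime (2 * F) p" using p(1) prime_imp_coprime coprime_commute by blast
  then obtain e where "[2 * F * e = 1] (mod p)" using cong_solve_coprime_int by blast
  then obtain r where r: "2 * F * e = 1 + p * r"
    by (metis cong_iff_lin cong_sym)
  define b where "b = (1 - a) * F * e + 2 * s * e"
  define c where "c = (1 - a) * F * e - 2 * s * e"
  have "b + c = (1 - a) * (2 * F * e)" unfolding b_def c_def by (simp add: algebra_simps power2_eq_square power3_eq_cube)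
  then have bc: "b + c = (1 - a) + p * ((1 - a) * r)" unfolding r by (simp add: algebra_simps power2_eq_square power3_eq_cube)
  have "\<exists>w. b * c = (a\<^sup>2 - a - 1) + p * w"
  proof -
    have "b * c = e\<^sup>2 * ((1 - a)\<^sup>2 * F\<^sup>2) - 4 * s\<^sup>2 * e\<^sup>2" unfolding b_def c_def by (simp add: algebra_simps power2_eq_square power3_eq_cube)
    also have "\<dots> = e\<^sup>2 * ((1 - a)\<^sup>2 * F\<^sup>2 + 44) - p * (4 * l * e\<^sup>2)" unfolding l by (simp add: algebra_simps power2_eq_square power3_eq_cube)
    \<comment> \<open>The quadratic f/(x - a) is x^2 + (a - 1)x + (a^2 - a - 1), so (1 - a)^2 equals
      its discriminant plus 4(a^2 - a - 1).\<close>
    also have "\<dots> = (2 * F * e)\<^sup>2 * (a\<^sup>2 - a - 1) + e\<^sup>2 * ((- 3 * a\<^sup>2 + 2 * a + 5) * F\<^sup>2 + 44) - p * (4 * l * e\<^sup>2)"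
      by (simp add: algebra_simps power2_eq_square power3_eq_cube)
    also have "\<dots> = (a\<^sup>2 - a - 1) + p * ((2 * r + p * r\<^sup>2) * (a\<^sup>2 - a - 1)
        + e\<^sup>2 * (k * (- 27 * a ^ 3 + 27 * a\<^sup>2 + 27 * a - 49)) - 4 * l * e\<^sup>2)"
      unfolding disc r by (simp add: algebra_simps power2_eq_square power3_eq_cube)
    finally show ?thesis by blast
  qed
  then obtain w where w: "b * c = (a\<^sup>2 - a - 1) + p * w" by blast
  define t where "t = (1 - a) * r"
  note bc = bc[folded t_def]
  have e1: "a + b + c = 1 + p * t" using bc by simp
  have e2: "a * b + a * c + b * c = -1 + p * (a * t + w)"
  proof -
    have "a * b + a * c + b * c = a * (b + c) + b * c" by (simp add: algebra_simps power2_eq_square power3_eq_cube)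
    then show ?thesis unfolding bc w by (simp add: algebra_simps power2_eq_square power3_eq_cube)
  qed
  have e3: "a * b * c = 1 + p * (k + a * w)"
  proof -
    have "a * b * c = a * (b * c)" by simp
    also have "\<dots> = 1 + (a ^ 3 - a\<^sup>2 - a - 1) + p * (a * w)" unfolding w by (simp add: algebra_simps power2_eq_square power3_eq_cube)
    also have "\<dots> = 1 + p * (k + a * w)" unfolding k by (simp add: algebra_simps power2_eq_square power3_eq_cube)
    finally show ?thesis .
  qed
  have "[:-a, 1:] * [:-b, 1:] * [:-c, 1:] = [:- (a * b * c), a * b + a * c + b * c, - (a + b + c), 1:]"
    by (simp add: algebra_simps)
  then have split: "trib_poly = [:-a, 1:] * [:-b, 1:] * [:-c, 1:] + [:p:] * [:k + a * w, - (a * t + w), t:]"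
    unfolding e1 e2 e3 by (simp add: trib_poly_def algebra_simps)
  \<comment> \<open>The product (a - b)(a - c) is f'(a) modulo p, a unit.\<close>
  have "(a - b) * (a - c) = a\<^sup>2 - a * (b + c) + b * c" by (simp add: algebra_simps power2_eq_square power3_eq_cube)
  also have "\<dots> = F + p * (w - a * t)" unfolding bc w F_def by (simp add: algebra_simps power2_eq_square power3_eq_cube)
  finally have "\<not> p dvd (a - b) * (a - c)"
    using F by (metis dvd_add_left_iff dvd_triv_left)
  then have "\<not> p dvd a - b" "\<not> p dvd a - c" by auto
  moreover have "\<not> p dvd b - c"
  proof
    assume "p dvd b - c"
    moreover have "b - c = 2 * 2 * s * e" unfolding b_def c_def by (simp add: algebra_simps power2_eq_square power3_eq_cube)
    ultimately have "p dvd s \<or> p dvd e" using p by (simp only: prime_dvd_mult_iff) simp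
    then show False
    proof
      assume "p dvd s"
      then have "p dvd s\<^sup>2" by (simp add: power2_eq_square)
      then show False using s p by (simp add: dvd_add_right_iff)
    next
      assume "p dvd e"
      then have "p dvd 2 * F * e" by simp
      then have "p dvd 1" unfolding r by (simp add: dvd_add_left_iff)
      then show False using p by auto
    qed
  qed
  ultimately show ?thesis using split that by blast
qed

lemma fermat_little_int:
  fixes a :: int
  assumes "prime p" "\<not> int p dvd a"
  shows "int p dvd a ^ (p - 1) - 1"
proof -
  define b where "b = nat (a mod int p)"
  have b: "int b = a mod int p" using assms by (simp add: b_def prime_gt_0_nat)
  have "\<not> p dvd b"
    using assms(2) by (metis b int_dvd_int_iff dvd_mod_iff dvd_refl)
  then have "[b ^ (p - 1) = 1] (mod p)" using assms by (intro fermat_theorem)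
  then have "[int b ^ (p - 1) = 1] (mod int p)"
    by (metis cong_int_iff of_nat_1 of_nat_power)
  moreover have "[int b ^ (p - 1) = a ^ (p - 1)] (mod int p)"
    unfolding b by (intro cong_pow) simp
  ultimately have "[a ^ (p - 1) = 1] (mod int p)" by (metis cong_sym cong_trans)
  then show ?thesis by (simp add: cong_iff_dvd_diff)
qed

text \<open>At each of the three roots both x and 1 + x are units modulo p, so Fermat makes x^(p-1)
  - 1 and (1 + x)^(p-1) - 1 vanish at all of them.\<close>

lemma trib_cong_fermat:
  assumes p: "prime p" "\<not> int p dvd 2" "\<not> int p dvd 11"
    and a: "int p dvd poly trib_poly a" and s: "int p dvd s\<^sup>2 + 11"
  shows "trib_cong (int p) ([:0, 1:] ^ (p - 1)) 1" "trib_cong (int p) ([:1, 1:] ^ (p - 1)) 1"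
proof -
  have P: "prime (int p)" using p by simp
  obtain b c r where split: "trib_poly = [:-a, 1:] * [:-b, 1:] * [:-c, 1:] + [:int p:] * r"
    and ne: "\<not> int p dvd a - b" "\<not> int p dvd a - c" "\<not> int p dvd b - c"
    using trib_poly_splits_mod_prime[OF P p(2,3) a s] .
  have "[:-a, 1:] * [:-b, 1:] * [:-c, 1:] - 0 = trib_poly * 1 + [:int p:] * (- r)"
    unfolding split by simp
  then have split': "trib_cong (int p) ([:-a, 1:] * [:-b, 1:] * [:-c, 1:]) 0"
    by (rule trib_congI)
  have b: "int p dvd poly trib_poly b" and c: "int p dvd poly trib_poly c"
    unfolding split by (simp_all only: poly_add poly_mult poly_pCons) simp_all
  have root: "\<not> int p dvd x" "\<not> int p dvd 1 + x" if "int p dvd poly trib_poly x" for x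
  proof -
    \<comment> \<open>At a root these read x(x^2 - x - 1) = 1 and (1 + x)(x - 1)^2 = 2 modulo
      p.\<close>
    have f: "poly trib_poly x = x * (x\<^sup>2 - x - 1) - 1" "poly trib_poly x = (1 + x) * (x\<^sup>2 - 2 * x + 1) - 2"
      by (simp_all add: trib_poly_def algebra_simps power2_eq_square)
    show "\<not> int p dvd x"
    proof
      assume "int p dvd x"
      then have "int p dvd x * (x\<^sup>2 - x - 1)" by simp
      then have "int p dvd 1" using that unfolding f(1) by (metis dvd_diff diff_diff_eq2 add_diff_cancel_left')
      then show False using P by auto
    qed
    show "\<not> int p dvd 1 + x"
    proof
      assume "int p dvd 1 + x"
      then have "int p dvd (1 + x) * (x\<^sup>2 - 2 * x + 1)" by simp
      then have "int p dvd 2" using that unfolding f(2) by (metis dvd_diff diff_diff_eq2 add_diff_cancel_left')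
      then show False using p by simp
    qed
  qed
  have diff: "trib_cong (int p) u 1" if "trib_cong (int p) (u - 1) 0" for u
    using that by (simp add: trib_cong_def)
  show "trib_cong (int p) ([:0, 1:] ^ (p - 1)) 1"
    by (intro diff trib_cong_0_if_roots[OF P split' ne])
      (simp_all add: fermat_little_int[OF p(1), simplified] root a b c)
  show "trib_cong (int p) ([:1, 1:] ^ (p - 1)) 1"
    by (intro diff trib_cong_0_if_roots[OF P split' ne])
      (simp_all add: fermat_little_int[OF p(1), simplified] root a b c)
qed

section \<open>Infinitely many suitable primes\<close>

text \<open>A prime factor of another class must be 1 modulo 3, so the cofactor is again 2 modulo 3
  and smaller.\<close>

lemma prime_factor_2_mod_3:
  fixes n :: nat
  assumes "n mod 3 = 2"
  shows "\<exists>p. prime p \<and> p dvd n \<and> p mod 3 = 2"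
  using assms
proof (induction n rule: less_induct)
  case (less n)
  then have "n \<noteq> 1" "n > 0" by auto
  then obtain p where p: "prime p" "p dvd n" using prime_factor_nat by blast
  show ?case
  proof (cases "p mod 3 = 2")
    case False
    obtain m where m: "n = p * m" using p by blast
    have "n mod 3 = (p mod 3) * m mod 3" by (simp add: m mod_mult_left_eq)
    moreover have "p mod 3 = 0 \<or> p mod 3 = 1" using False by arith
    ultimately have "m mod 3 = 2" using less.prems by auto
    moreover have "m < n" using m \<open>n > 0\<close> prime_gt_1_nat[OF p(1)] by simp
    ultimately show ?thesis using less.IH m by (metis dvd_mult)
  qed (use p in blast)
qed

lemma prime_factor_norm_form:
  fixes x y :: int
  assumes "(x\<^sup>2 + 11 * y\<^sup>2) mod 3 = 2"
  shows "\<exists>p s. prime p \<and> p mod 3 = 2 \<and> int p dvd x\<^sup>2 + 11 * y\<^sup>2 \<and> int p dvd s\<^sup>2 + 11"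
  using assms
proof (induction "nat (x\<^sup>2 + 11 * y\<^sup>2)" arbitrary: x y rule: less_induct)
  case less
  \<comment> \<open>If $-11$ is not a square modulo $p$, then $p$ divides both $x$ and $y$, and dividing
    both by $p$ does not change the norm modulo $3$.\<close>
  let ?G = "x\<^sup>2 + 11 * y\<^sup>2"
  have G: "?G > 0"
  proof -
    have "?G \<ge> 0" by simp
    moreover have "?G \<noteq> 0" using less.prems by auto
    ultimately show ?thesis by linarith
  qed
  then have "nat ?G mod 3 = 2" using less.prems by (simp add: nat_mod_distrib[symmetric] flip: nat_numeral)
  then obtain p where p: "prime p" "p dvd nat ?G" "p mod 3 = 2"
    using prime_factor_2_mod_3 by blast
  have P: "prime (int p)" using p by simp
  have pG: "int p dvd ?G" using p(2) G by (metis int_dvd_int_iff int_nat_eq order_less_imp_le)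
  show ?case
  proof (cases "int p dvd y")
    case False
    then have "coprime y (int p)" using P prime_imp_coprime coprime_commute by blast
    then obtain z where z: "[y * z = 1] (mod int p)" using cong_solve_coprime_int by blast
    \<comment> \<open>With z inverse to y modulo p, the quotient x/y is a square root of
      -11.\<close>
    have "[(x * z)\<^sup>2 + 11 * 1\<^sup>2 = (x * z)\<^sup>2 + 11 * (y * z)\<^sup>2] (mod int p)"
      by (intro cong_add cong_mult cong_pow cong_refl cong_sym[OF z])
    also have "(x * z)\<^sup>2 + 11 * (y * z)\<^sup>2 = ?G * z\<^sup>2" by (simp add: algebra_simps power2_eq_square power3_eq_cube)
    finally have "int p dvd (x * z)\<^sup>2 + 11 \<longleftrightarrow> int p dvd ?G * z\<^sup>2"
      using cong_dvd_iff by fastforce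
    then show ?thesis using p pG by auto
  next
    case True
    then have "int p dvd 11 * y\<^sup>2" by (simp add: power2_eq_square)
    then have "int p dvd x\<^sup>2" using pG by (simp add: dvd_add_left_iff)
    then have "int p dvd x" using P by (rule prime_dvd_power[rotated])
    then obtain x' y' where xy: "x = int p * x'" "y = int p * y'" using True by blast
    let ?G' = "x'\<^sup>2 + 11 * y'\<^sup>2"
    have GG: "?G = (int p)\<^sup>2 * ?G'" unfolding xy by (simp add: algebra_simps power2_eq_square power3_eq_cube)
    have "[int p = 2] (mod 3)" using p(3) zmod_int[of p 3] by (simp add: cong_def)
    then have "[(int p)\<^sup>2 * ?G' = 2\<^sup>2 * ?G'] (mod 3)" by (intro cong_mult cong_pow cong_refl)
    also have "[2\<^sup>2 * ?G' = ?G'] (mod 3)" by (simp add: cong_iff_dvd_diff)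
    finally have m: "?G' mod 3 = 2" using less.prems GG by (simp add: cong_def)
    have "?G' > 0" using G GG by (simp add: zero_less_mult_iff)
    moreover have "(int p)\<^sup>2 > 1" using prime_gt_1_nat[OF p(1)] by (simp add: power2_eq_square less_1_mult)
    ultimately have "?G' < ?G" unfolding GG by simp
    then have "nat ?G' < nat ?G" using G by simp
    from less.hyps[OF this m] show ?thesis unfolding GG by (meson dvd_mult)
  qed
qed

text \<open>Splitting of f is recorded through the orders of \<theta> and \<theta> + 1, the form in
  which it is lifted to prime powers; oddness makes 2 a unit.\<close>

definition trib_split_primes :: "nat set" where
  "trib_split_primes = {p. prime p \<and> p mod 3 = 2 \<and> odd p \<and>
     trib_cong (int p) ([:0, 1:] ^ (p - 1)) 1 \<and> trib_cong (int p) ([:1, 1:] ^ (p - 1)) 1}"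

lemma infinite_trib_split_primes: "infinite trib_split_primes"
proof
  assume fin: "finite trib_split_primes"
  \<comment> \<open>The factor 22 keeps the new prime away from 2 and 11, and the product keeps it
    away from the old primes.\<close>
  define N where "N = 22 * \<Prod>trib_split_primes"
  define M where "M = int N"
  have dvdN: "q dvd N" if "q \<in> trib_split_primes" for q
    unfolding N_def using dvd_prodI[OF fin that, of "\<lambda>x. x"] by simp
  have "\<not> 3 dvd N"
  proof
    assume "3 dvd N"
    then have "3 dvd (22 :: nat) \<or> (\<exists>q\<in>trib_split_primes. 3 dvd q)"
      unfolding N_def by (simp add: prime_dvd_mult_iff prime_dvd_prod_iff fin del: dvd_numeral_simp)
    then show False by (auto simp: trib_split_primes_def)
  qed
  then have M3: "M mod 3 = 1 \<or> M mod 3 = 2" unfolding M_def by presburger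
  \<comment> \<open>$W(s^2) = f(M + Ms) f(M - Ms)$\<close>
  define W where "W z = (M ^ 3 + 3 * M ^ 3 * z - M\<^sup>2 - M\<^sup>2 * z - M - 1)\<^sup>2
    - z * (M * (3 * M\<^sup>2 + M\<^sup>2 * z - 2 * M - 1))\<^sup>2" for z
  \<comment> \<open>These are the two coordinates of f(M + M sqrt(-11)), so W(-11) is its
    norm.\<close>
  define x where "x = - 32 * M ^ 3 + 10 * M\<^sup>2 - M - 1"
  define y where "y = M * (- 8 * M\<^sup>2 - 2 * M - 1)"
  have W: "W (- 11) = x\<^sup>2 + 11 * y\<^sup>2" unfolding W_def x_def y_def by simp
  have "(x\<^sup>2 + 11 * y\<^sup>2) mod 3 = 2"
  proof -
    have *: "[x\<^sup>2 + 11 * y\<^sup>2 = (- 32 * t ^ 3 + 10 * t\<^sup>2 - t - 1)\<^sup>2 + 11 * (t * (- 8 * t\<^sup>2 - 2 * t - 1))\<^sup>2] (mod 3)"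
      if "[M = t] (mod 3)" for t
      unfolding x_def y_def by (intro cong_add cong_diff cong_mult cong_pow cong_refl that)
    show ?thesis using M3
    proof
      assume "M mod 3 = 1"
      then show ?thesis using *[of 1] by (simp add: cong_def)
    next
      assume "M mod 3 = 2"
      then show ?thesis using *[of 2] by (simp add: cong_def)
    qed
  qed
  then obtain p s where p: "prime p" "p mod 3 = 2" and G: "int p dvd x\<^sup>2 + 11 * y\<^sup>2"
    and s: "int p dvd s\<^sup>2 + 11"
    using prime_factor_norm_form by blast
  have P: "prime (int p)" using p by simp
  have pM: "\<not> int p dvd M"
  proof
    assume "int p dvd M"
    \<comment> \<open>As x is -1 and y is 0 modulo M, the norm is 1 modulo M.\<close>
    moreover have "x\<^sup>2 + 11 * y\<^sup>2 = M * (M * (- 32 * M\<^sup>2 + 10 * M - 1)\<^sup>2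
        - 2 * (- 32 * M\<^sup>2 + 10 * M - 1) + 11 * M * (- 8 * M\<^sup>2 - 2 * M - 1)\<^sup>2) + 1"
      unfolding x_def y_def by (simp add: algebra_simps power2_eq_square power3_eq_cube)
    ultimately have "int p dvd 1" using G by (metis dvd_add_right_iff dvd_mult2)
    then show False using P by auto
  qed
  have "M = 2 * (11 * int (\<Prod>trib_split_primes))" "M = 11 * (2 * int (\<Prod>trib_split_primes))"
    unfolding M_def N_def by simp_all
  then have p2: "\<not> int p dvd 2" and p11: "\<not> int p dvd 11" using pM by (metis dvd_mult2)+
  have "\<exists>a. int p dvd poly trib_poly a"
  proof -
    have "[s\<^sup>2 = - 11] (mod int p)" using s by (simp add: cong_iff_dvd_diff)
    \<comment> \<open>W has integer coefficients, so s may replace sqrt(-11) modulo p. The norm then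
      factors, and M + Ms or M - Ms is a root of f.\<close>
    then have "[W (s\<^sup>2) = W (- 11)] (mod int p)"
      unfolding W_def by (intro cong_add cong_diff cong_mult cong_pow cong_refl)
    then have "int p dvd W (s\<^sup>2)" using G cong_dvd_iff unfolding W by blast
    moreover have "W (s\<^sup>2) = poly trib_poly (M + M * s) * poly trib_poly (M - M * s)"
      unfolding W_def poly_trib_poly by (simp add: algebra_simps power2_eq_square power3_eq_cube)
    ultimately show ?thesis using P by (metis prime_dvd_mult_iff)
  qed
  then obtain a where a: "int p dvd poly trib_poly a" by blast
  have "odd p" using p2 p(1)
    by (metis dvd_refl primes_dvd_imp_eq two_is_prime_nat of_nat_numeral)
  with p trib_cong_fermat[OF p(1) p2 p11 a s] have "p \<in> trib_split_primes"
    by (simp add: trib_split_primes_def)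
  then show False using dvdN pM unfolding M_def by simp
qed

section \<open>From prime powers to p-adic valuations\<close>

text \<open>Since p - 1 and p^k are coprime, their product divides 3n - 1. It is an exponent for
  \<theta> and \<theta> + 1 modulo p^(k+1), which gives one power of p more than claimed.\<close>

lemma trib_dvd_prime_power:
  assumes p: "p \<in> trib_split_primes"
    and n: "int (p - 1) dvd 3 * n - 1" "int p ^ k dvd 3 * n - 1"
  shows "int p ^ k dvd trib n" "int p ^ k dvd trib (n - 2)"
proof -
  from p have pr: "prime p" and "odd p"
    and X: "trib_cong (int p) ([:0, 1:] ^ (p - 1)) 1" and Y: "trib_cong (int p) ([:1, 1:] ^ (p - 1)) 1"
    by (auto simp: trib_split_primes_def)
  have "coprime (p - 1) p" using pr by (metis coprime_diff_one_left_nat prime_gt_0_nat)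
  then have "coprime (int (p - 1)) (int p ^ k)" by simp
  then have "int (p - 1) * int p ^ k dvd 3 * n - 1" using n by (intro divides_mult)
  then have d: "int ((p - 1) * p ^ k) dvd 3 * n - 1" by simp
  have "(p - 1) * p ^ k > 0" using prime_gt_1_nat[OF pr] by simp
  moreover have "coprime (int p ^ Suc k) 2" using \<open>odd p\<close> by simp
  ultimately have "int p ^ Suc k dvd trib n" "int p ^ Suc k dvd trib (n - 2)"
    using trib_dvd_of_power_cong[OF trib_cong_power_1_prime_power[OF X] trib_cong_power_1_prime_power[OF Y] _ d]
    by blast+
  then show "int p ^ k dvd trib n" "int p ^ k dvd trib (n - 2)"
    by (auto intro: dvd_trans[of _ "int p ^ Suc k"])
qed

text \<open>Clearing denominators gives m(3n - c) = 3(a - b), and m is a unit modulo M. The cases c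
  = 1 and c = -5 are the two classes of the theorem.\<close>

lemma rat_cong_thirdD:
  assumes "rat_cong (of_int n) (of_int c / 3) M"
  shows "int M dvd 3 * n - c"
proof -
  from assms obtain m a b :: int where m: "coprime m (int M)"
    and "rat_of_int a = of_int m * of_int n" "rat_of_int b = of_int m * (of_int c / 3)"
    and ab: "[a = b] (mod int M)"
    unfolding rat_cong_def by blast
  then have "rat_of_int a = of_int (m * n)" "rat_of_int (3 * b) = of_int (m * c)" by simp_all
  then have "a = m * n" "3 * b = m * c" by (simp_all only: of_int_eq_iff)
  then have "m * (3 * n - c) = 3 * (a - b)" by (simp add: algebra_simps)
  moreover have "int M dvd 3 * (a - b)" using ab unfolding cong_iff_dvd_diff by (rule dvd_mult)
  ultimately have "int M dvd m * (3 * n - c)" by simp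
  then show ?thesis using m by (simp add: coprime_dvd_mult_right_iff coprime_commute)
qed

text \<open>The fraction is already reduced, and its denominator 3 is prime to p.\<close>

lemma padic_val_third:
  assumes "prime p" "p \<noteq> 3" "\<not> 3 dvd a"
  shows "padic_val p (of_int a / 3) = ereal (multiplicity (int p) a)"
proof -
  have "coprime a 3" using assms(3) by (simp add: prime_imp_coprime coprime_commute[of a])
  then have "quotient_of (of_int a / 3) = (a, 3)"
    using quotient_of_Fract[of a 3] by (simp add: Fract_of_int_quotient normalize_stable)
  moreover have "\<not> int p dvd 3" using assms
    using primes_dvd_imp_eq[of p 3] int_dvd_int_iff[of p 3] by auto
  then have "multiplicity (int p) 3 = 0" by (rule not_dvd_imp_multiplicity_0)
  moreover have "a \<noteq> 0" using assms by auto
  ultimately show ?thesis by (simp add: padic_val_def)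
qed

lemma padic_val_of_int_ge:
  assumes "prime p" "int p ^ k dvd a"
  shows "padic_val p (of_int a) \<ge> ereal k"
proof (cases "a = 0")
  case False
  have "k \<le> multiplicity (int p) a"
    using assms False by (intro multiplicity_geI) auto
  with False show ?thesis by (simp add: padic_val_def)
qed (simp add: padic_val_def)

lemma padic_val_trib_ge:
  assumes p: "p \<in> trib_split_primes" and n: "int (p - 1) dvd 3 * n - 1"
  shows "padic_val p (of_int (trib n)) \<ge> padic_val p (of_int (3 * n - 1) / 3)"
    "padic_val p (of_int (trib (n - 2))) \<ge> padic_val p (of_int (3 * n - 1) / 3)"
proof -
  have pr: "prime p" and "p \<noteq> 3" using p by (auto simp: trib_split_primes_def)
  moreover have "\<not> 3 dvd 3 * n - 1" by presburger
  ultimately have v: "padic_val p (of_int (3 * n - 1) / 3) = ereal (multiplicity (int p) (3 * n - 1))"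
    by (rule padic_val_third)
  \<comment> \<open>Here k is the exact exponent of p in 3n - 1.\<close>
  note d = trib_dvd_prime_power[OF p n multiplicity_dvd]
  show "padic_val p (of_int (trib n)) \<ge> padic_val p (of_int (3 * n - 1) / 3)"
    "padic_val p (of_int (trib (n - 2))) \<ge> padic_val p (of_int (3 * n - 1) / 3)"
    unfolding v by (rule padic_val_of_int_ge[OF pr d(1)], rule padic_val_of_int_ge[OF pr d(2)])
qed

theorem theorem4:
  shows "\<exists>S :: nat set. infinite S \<and> (\<forall>p\<in>S. prime p \<and> [p = 2] (mod 3)) \<and>
    (\<forall>p\<in>S.
      (\<forall>n :: int. rat_cong (of_int n) (1/3) (p - 1) \<longrightarrow>
          padic_val p (of_int (trib n)) \<ge> padic_val p (of_int n - 1/3)) \<and>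
      (\<forall>n :: int. rat_cong (of_int n) (-5/3) (p - 1) \<longrightarrow>
          padic_val p (of_int (trib n)) \<ge> padic_val p (of_int n + 5/3)))"
proof (intro exI[of _ trib_split_primes] conjI ballI allI impI infinite_trib_split_primes)
  fix p assume p: "p \<in> trib_split_primes"
  then show "prime p" "[p = 2] (mod 3)" by (auto simp: trib_split_primes_def cong_def)
  fix n :: int
  {
    assume "rat_cong (of_int n) (1/3) (p - 1)"
    then have "int (p - 1) dvd 3 * n - 1" using rat_cong_thirdD[of n 1] by simp
    moreover have "rat_of_int (3 * n - 1) / 3 = of_int n - 1/3" by (simp add: field_simps)
    ultimately show "padic_val p (of_int (trib n)) \<ge> padic_val p (of_int n - 1/3)"
      using padic_val_trib_ge(1)[OF p] by metis
  next
    assume "rat_cong (of_int n) (-5/3) (p - 1)"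
    then have "int (p - 1) dvd 3 * n - (- 5)" by (intro rat_cong_thirdD) simp
    \<comment> \<open>Since n + 5/3 = (n + 2) - 1/3, the second class follows from the bound on T((n
      + 2) - 2).\<close>
    then have "int (p - 1) dvd 3 * (n + 2) - 1" by (simp add: algebra_simps)
    moreover have "rat_of_int (3 * (n + 2) - 1) / 3 = of_int n + 5/3" by (simp add: field_simps)
    ultimately show "padic_val p (of_int (trib n)) \<ge> padic_val p (of_int n + 5/3)"
      using padic_val_trib_ge(2)[OF p, of "n + 2"] by (metis add_diff_cancel_right')
  }
qed

end
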